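(* Let $N\ge 2$, $h=1/N$, $x_j=jh$ for $0\le j\le N$, and let $\mathfrak{u}\in l^2_{h,0}$. Let $s_{\mathfrak{u}}$ be the cubic spline interpolating $\mathfrak{u}$ and let $\mathfrak{u}_x\in l^2_{h,0}$ be the Hermitian derivative of $\mathfrak{u}$ (so that at the endpoints $\mathfrak{u}_x(x_0)=s_{\mathfrak{u}}'(x_0)=0$ and $\mathfrak{u}_x(x_N)=s_{\mathfrak{u}}'(x_N)=0$). Then for all interior nodes $$s_{\mathfrak{u}}'(x_j)=\mathfrak{u}_x(x_j),\qquad 1\le j\le N-1 .$$
   Context: $\Omega=[0,1]$. A grid function is a vector $\mathfrak{v}=(\mathfrak{v}_j)_{j=0}^N$ (one also writes $\mathfrak{v}(x_j)=\mathfrak{v}_j$); $l^2_{h,0}$ is the space of grid functions with $\mathfrak{v}_0=\mathfrak{v}_N=0$. $H^2_0(\Omega)$ is the space of functions with first and second distributional derivatives in $L^2(\Omega)$ that vanish together with their first derivatives at $0$ and $1$. Cubic spline: for $\mathfrak{u}\in l^2_{h,0}$, $s_{\mathfrak{u}}$ is the unique function in $C^2(\Omega)\cap H^2_0(\Omega)$ that is a polynomial of degree at most $3$ on each interval $[x_j,x_{j+1}]$, $0\le j\le N-1$, and satisfies $s_{\mathfrak{u}}(x_j)=\mathfrak{u}_j$ for $0\le j\le N$ (so also $s_{\mathfrak{u}}'(0)=s_{\mathfrak{u}}'(1)=0$). Hermitian derivative: for $\mathfrak{u}\in l^2_{h,0}$, $\mathfrak{u}_x$ is the unique element of $l^2_{h,0}$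 (so $(\mathfrak{u}_x)_0=(\mathfrak{u}_x)_N=0$) with $$\tfrac16(\mathfrak{u}_x)_{j-1}+\tfrac23(\mathfrak{u}_x)_j+\tfrac16(\mathfrak{u}_x)_{j+1}=\frac{\mathfrak{u}_{j+1}-\mathfrak{u}_{j-1}}{2h},\qquad 1\le j\le N-1.$$ *)

theory Defs
  imports "HOL-Analysis.Analysis" "HOL-Computational_Algebra.Polynomial"
begin

definition grid_step :: "nat \<Rightarrow> real" where
  "grid_step N = 1 / real N"

definition grid_node :: "nat \<Rightarrow> nat \<Rightarrow> real" where
  "grid_node N j = real j * grid_step N"

text \<open>A grid function is a function on \<open>nat\<close> of which only the values at \<open>0, \<dots>, N\<close> are
  meaningful; nothing below constrains or uses the others.\<close>

definition l2h0 :: "nat \<Rightarrow> (nat \<Rightarrow> real) set" where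
  "l2h0 N = {v. v 0 = 0 \<and> v N = 0}"

definition is_hermitian_derivative :: "nat \<Rightarrow> (nat \<Rightarrow> real) \<Rightarrow> (nat \<Rightarrow> real) \<Rightarrow> bool" where
  "is_hermitian_derivative N u v \<longleftrightarrow>
     v \<in> l2h0 N \<and>
     (\<forall>j\<in>{1..N-1}. 1/6 * v (j - 1) + 2/3 * v j + 1/6 * v (j + 1)
        = (u (j + 1) - u (j - 1)) / (2 * grid_step N))"

definition L2_Omega :: "(real \<Rightarrow> real) set" where
  "L2_Omega = {f. f \<in> borel_measurable (lebesgue_on {0..1}) \<and>
                  integrable (lebesgue_on {0..1}) (\<lambda>x. (f x)\<^sup>2)}"

text \<open>Test functions for the open interval: a closed set contained in \<open>{0<..<1}\<close> is
  automatically compact.\<close>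

definition test_function :: "(real \<Rightarrow> real) \<Rightarrow> bool" where
  "test_function \<phi> \<longleftrightarrow>
     (\<forall>n x. ((deriv ^^ n) \<phi>) differentiable (at x)) \<and>
     closure {x. \<phi> x \<noteq> 0} \<subseteq> {0<..<1}"

text \<open>Both arguments are meant to be in \<open>L2_Omega\<close>, which makes the two integrands integrable.\<close>

definition weak_derivative :: "(real \<Rightarrow> real) \<Rightarrow> (real \<Rightarrow> real) \<Rightarrow> bool" where
  "weak_derivative f g \<longleftrightarrow>
     (\<forall>\<phi>. test_function \<phi> \<longrightarrow>
        integral\<^sup>L (lebesgue_on {0..1}) (\<lambda>x. f x * deriv \<phi> x)
        = - integral\<^sup>L (lebesgue_on {0..1}) (\<lambda>x. g x * \<phi> x))"

text \<open>Derivatives are taken within the closed interval, hence one-sided at the endpoints.\<close>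

definition C1_with :: "(real \<Rightarrow> real) \<Rightarrow> (real \<Rightarrow> real) \<Rightarrow> bool" where
  "C1_with f f' \<longleftrightarrow>
     (\<forall>x\<in>{0..1}. (f has_real_derivative f' x) (at x within {0..1})) \<and>
     continuous_on {0..1} f'"

definition C2_Omega :: "(real \<Rightarrow> real) set" where
  "C2_Omega = {f. \<exists>f' f''. C1_with f f' \<and> C1_with f' f''}"

text \<open>An element of \<open>H\<^sup>2\<close> is determined only almost everywhere; its values and the values of its
  first derivative at \<open>0\<close> and \<open>1\<close> are those of its continuously differentiable representative
  \<open>F\<close>.\<close>

definition H20_Omega :: "(real \<Rightarrow> real) set" where
  "H20_Omega = {f. f \<in> L2_Omega \<and>
     (\<exists>g1\<in>L2_Omega. \<exists>g2\<in>L2_Omega. weak_derivative f g1 \<and> weak_derivative g1 g2) \<and>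
     (\<exists>F F'. C1_with F F' \<and> (AE x in lebesgue_on {0..1}. f x = F x) \<and>
             F 0 = 0 \<and> F 1 = 0 \<and> F' 0 = 0 \<and> F' 1 = 0)}"

text \<open>The spline as a function on the real line of which only the restriction to \<open>{0..1}\<close> is
  constrained; this restriction is unique.\<close>

definition is_cubic_spline :: "nat \<Rightarrow> (nat \<Rightarrow> real) \<Rightarrow> (real \<Rightarrow> real) \<Rightarrow> bool" where
  "is_cubic_spline N u s \<longleftrightarrow>
     s \<in> C2_Omega \<inter> H20_Omega \<and>
     (\<forall>j<N. \<exists>p::real poly. degree p \<le> 3 \<and>
        (\<forall>x\<in>{grid_node N j..grid_node N (j + 1)}. s x = poly p x)) \<and>
     (\<forall>j\<le>N. s (grid_node N j) = u j)"

end

theory Submission imports Defs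
begin

text \<open>On one cell a cubic \<open>p\<close> is determined by its values and slopes at the two ends, and so are
  its two end values of \<open>p''\<close>. At an interior node the values of \<open>s''\<close> computed from the cells on
  the left and on the right agree because \<open>s\<close> is \<open>C\<^sup>2\<close>; written in terms of the values
  and slopes this is exactly the Hermitian relation for \<open>s'(x\<^sub>j)\<close>
  (\<open>cubic_second_derivative_left\<close>, \<open>cubic_second_derivative_right\<close>). The boundary slopes of \<open>s\<close>
  vanish because \<open>C\<^sup>1\<close> functions that are almost everywhere equal on the closed interval have equal
  derivatives there, so that membership in \<open>H\<^sup>2\<^sub>0\<close> speaks about \<open>s\<close> itself
  (\<open>C1_with_derivative_unique_AE\<close>). Thus the slopes of the spline and the Hermitian derivative solve
  the same tridiagonal system with the same boundary values. The system is diagonally dominant, which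
  makes its solution unique (\<open>tridiagonal_solution_zero\<close>).\<close>

lemma degree_le_3_form:
  fixes p :: "'a::comm_ring_1 poly"
  assumes "degree p \<le> 3"
  obtains a b c d where "p = [:a, b, c, d:]"
proof
  show "p = [:coeff p 0, coeff p 1, coeff p 2, coeff p 3:]"
  proof (rule poly_eqI)
    fix n
    show "coeff p n = coeff [:coeff p 0, coeff p 1, coeff p 2, coeff p 3:] n"
      using coeff_eq_0[of p n] assms
      by (auto simp: coeff_pCons eval_nat_numeral split: nat.splits)
  qed
qed

text \<open>Values and slopes at \<open>a\<close> and \<open>b\<close> are the Hermite interpolation data of \<open>p\<close>, so they fix its
  second derivative; multiplying by \<open>(b - a)\<^sup>2\<close> turns the formulas into polynomial identities in
  \<open>a\<close>, \<open>b\<close> and the coefficients of \<open>p\<close>.\<close>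

lemma cubic_second_derivative_right:
  fixes p :: "real poly"
  assumes "degree p \<le> 3"
  shows "(b - a)\<^sup>2 * poly (pderiv (pderiv p)) b
    = (b - a) * (4 * poly (pderiv p) b + 2 * poly (pderiv p) a) - 6 * (poly p b - poly p a)"
  using assms
  by (elim degree_le_3_form) (simp add: pderiv_pCons power2_eq_square algebra_simps)

lemma cubic_second_derivative_left:
  fixes p :: "real poly"
  assumes "degree p \<le> 3"
  shows "(b - a)\<^sup>2 * poly (pderiv (pderiv p)) a
    = 6 * (poly p b - poly p a) - (b - a) * (4 * poly (pderiv p) a + 2 * poly (pderiv p) b)"
  using assms
  by (elim degree_le_3_form) (simp add: pderiv_pCons power2_eq_square algebra_simps)

lemma real_derivative_within_Icc_unique:
  fixes f g :: "real \<Rightarrow> real"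
  assumes "(f has_real_derivative D) (at x within S)" "(g has_real_derivative E) (at x within T)"
    and "a < b" "{a..b} \<subseteq> S" "{a..b} \<subseteq> T" "x \<in> {a..b}" "\<And>y. y \<in> {a..b} \<Longrightarrow> f y = g y"
  shows "D = E"
proof -
  have f: "(f has_real_derivative D) (at x within {a..b})"
    using assms DERIV_subset by blast
  have "(g has_real_derivative E) (at x within {a..b})"
    using assms DERIV_subset by blast
  then have "(f has_real_derivative E) (at x within {a..b})"
    by (rule has_field_derivative_transform_within[where d = 1]) (use assms in auto)
  then show ?thesis
    using f assms(3,6) vector_derivative_unique_within_closed_interval[of a b x f D E]
    by (simp add: has_real_derivative_iff_has_vector_derivative box_real)
qed

lemma C1_with_continuous_on: "C1_with f f' \<Longrightarrow> continuous_on {0..1} f"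
  unfolding C1_with_def by (blast intro: DERIV_continuous_on)

text \<open>The set of agreement is closed in \<open>[0,1]\<close> and of full measure, hence dense.\<close>

lemma continuous_on_AE_eq_unit_interval:
  fixes f g :: "real \<Rightarrow> real"
  assumes "continuous_on {0..1} f" "continuous_on {0..1} g"
    and ae: "AE x in lebesgue_on {0..1}. f x = g x"
    and "x \<in> {0..1}"
  shows "f x = g x"
proof -
  define C where "C = {x \<in> {0..1}. f x = g x}"
  have "closed C"
    using continuous_closed_preimage_constant[of "{0..1}" "\<lambda>x. f x - g x" 0] assms
    by (auto simp: C_def intro: continuous_on_diff)
  have "AE x in lebesgue. x \<in> {0<..<1} \<longrightarrow> x \<in> C"
    using ae by (auto simp: C_def AE_restrict_space_iff elim!: eventually_mono)
  then have "{0<..<1} \<subseteq> C"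
    using mem_closed_if_AE_lebesgue_open[OF open_greaterThanLessThan \<open>closed C\<close>] by blast
  then have "closure {0<..<1} \<subseteq> C"
    using \<open>closed C\<close> by (rule closure_minimal)
  then show ?thesis
    using \<open>x \<in> {0..1}\<close> by (auto simp: C_def)
qed

lemma C1_with_derivative_unique_AE:
  assumes "C1_with f f'" "C1_with g g'" "AE x in lebesgue_on {0..1}. f x = g x" "x \<in> {0..1}"
  shows "f' x = g' x"
proof (rule real_derivative_within_Icc_unique)
  show "(f has_real_derivative f' x) (at x within {0..1})"
    "(g has_real_derivative g' x) (at x within {0..1})"
    using assms by (auto simp: C1_with_def)
  show "f y = g y" if "y \<in> {0..1}" for y
    using assms that by (blast intro: continuous_on_AE_eq_unit_interval C1_with_continuous_on)
qed (use assms in auto)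

text \<open>Passing from \<open>s\<close> to \<open>p\<close> commutes with differentiation up to the ends of the cell, because
  one-sided derivatives already determine the derivative there.\<close>

lemma C2_piece_derivatives:
  fixes p :: "real poly"
  assumes "C1_with s s'" "C1_with s' s''" "0 \<le> a" "a < b" "b \<le> 1"
    and eq: "\<And>x. x \<in> {a..b} \<Longrightarrow> s x = poly p x"
    and "x \<in> {a..b}"
  shows "s' x = poly (pderiv p) x" "s'' x = poly (pderiv (pderiv p)) x"
proof -
  have d: "s' y = poly (pderiv p) y" if "y \<in> {a..b}" for y
    by (rule real_derivative_within_Icc_unique[of s _ y "{0..1}" "poly p" _ UNIV a b])
       (use assms that in \<open>auto simp: C1_with_def\<close>)
  show "s' x = poly (pderiv p) x" using d assms by blast
  show "s'' x = poly (pderiv (pderiv p)) x"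
    by (rule real_derivative_within_Icc_unique[of s' _ x "{0..1}" "poly (pderiv p)" _ UNIV a b])
       (use assms d in \<open>auto simp: C1_with_def\<close>)
qed

text \<open>At an index where \<open>\<bar>e\<bar>\<close> is maximal, the relation bounds the maximum by half of itself.\<close>

lemma tridiagonal_solution_zero:
  fixes e :: "nat \<Rightarrow> real"
  assumes "e 0 = 0" "e N = 0"
    and rel: "\<And>j. j \<in> {1..N-1} \<Longrightarrow> 1/6 * e (j - 1) + 2/3 * e j + 1/6 * e (j + 1) = 0"
    and "j \<le> N"
  shows "e j = 0"
proof -
  obtain k where k: "k \<le> N" "\<And>i. i \<le> N \<Longrightarrow> \<bar>e i\<bar> \<le> \<bar>e k\<bar>"
    using Max_in[of "(\<lambda>i. \<bar>e i\<bar>) ` {..N}"] Max_ge[of "(\<lambda>i. \<bar>e i\<bar>) ` {..N}"]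
    by fastforce
  have "e k = 0"
  proof (cases "k = 0 \<or> k = N")
    case False
    then have "k \<in> {1..N-1}" using k by auto
    then have "k - 1 \<le> N" "k + 1 \<le> N" by auto
    with rel[OF \<open>k \<in> {1..N-1}\<close>] k(2)[of "k - 1"] k(2)[of "k + 1"]
    show ?thesis by linarith
  qed (use assms in auto)
  then show ?thesis using k(2)[OF \<open>j \<le> N\<close>] by simp
qed

lemma grid_node_Suc: "grid_node N (Suc j) = grid_node N j + grid_step N"
  by (simp add: grid_node_def algebra_simps)

lemma grid_step_pos: "N > 0 \<Longrightarrow> grid_step N > 0"
  by (simp add: grid_step_def)

lemma grid_node_in_unit_interval: "j \<le> N \<Longrightarrow> grid_node N j \<in> {0..1}"
  by (auto simp: grid_node_def grid_step_def divide_simps)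

lemma spline_second_derivative_at_nodes:
  assumes "is_cubic_spline N u s" "C1_with s s'" "C1_with s' s''" "j < N"
  defines "h \<equiv> grid_step N" and "x \<equiv> grid_node N"
  shows "h\<^sup>2 * s'' (x (Suc j)) = h * (4 * s' (x (Suc j)) + 2 * s' (x j)) - 6 * (u (Suc j) - u j)"
    and "h\<^sup>2 * s'' (x j) = 6 * (u (Suc j) - u j) - h * (4 * s' (x j) + 2 * s' (x (Suc j)))"
proof -
  obtain p :: "real poly" where p: "degree p \<le> 3"
    "\<And>y. y \<in> {x j..x (Suc j)} \<Longrightarrow> s y = poly p y"
    using assms by (auto simp: is_cubic_spline_def)
  have step: "x (Suc j) - x j = h" and lt: "x j < x (Suc j)"
    using assms grid_step_pos[of N] by (auto simp: grid_node_Suc)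
  have unit: "0 \<le> x j" "x (Suc j) \<le> 1"
    using assms grid_node_in_unit_interval[of j N] grid_node_in_unit_interval[of "Suc j" N] by auto
  have d: "s' y = poly (pderiv p) y" "s'' y = poly (pderiv (pderiv p)) y"
    if "y \<in> {x j..x (Suc j)}" for y
    using C2_piece_derivatives[OF assms(2,3) unit(1) lt unit(2) _ that, of p] p(2) by auto
  have val: "poly p (x j) = u j" "poly p (x (Suc j)) = u (Suc j)"
    using assms p(2)[of "x j"] p(2)[of "x (Suc j)"] lt by (auto simp: is_cubic_spline_def)
  show "h\<^sup>2 * s'' (x (Suc j)) = h * (4 * s' (x (Suc j)) + 2 * s' (x j)) - 6 * (u (Suc j) - u j)"
    using cubic_second_derivative_right[OF p(1), of "x (Suc j)" "x j"] lt
    by (simp add: step val d)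
  show "h\<^sup>2 * s'' (x j) = 6 * (u (Suc j) - u j) - h * (4 * s' (x j) + 2 * s' (x (Suc j)))"
    using cubic_second_derivative_left[OF p(1), of "x (Suc j)" "x j"] lt
    by (simp add: step val d)
qed

lemma spline_nodal_slopes_hermitian:
  assumes "N > 0" and spline: "is_cubic_spline N u s" and C1: "C1_with s s'" "C1_with s' s''"
  shows "is_hermitian_derivative N u (\<lambda>j. s' (grid_node N j))"
proof -
  obtain F F' where F: "C1_with F F'" "AE x in lebesgue_on {0..1}. s x = F x" "F' 0 = 0" "F' 1 = 0"
    using spline by (auto simp: is_cubic_spline_def H20_Omega_def)
  have "s' 0 = 0" "s' 1 = 0"
    using C1_with_derivative_unique_AE[OF C1(1) F(1,2), of 0]
      C1_with_derivative_unique_AE[OF C1(1) F(1,2), of 1] F(3,4) by auto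
  then have boundary: "(\<lambda>j. s' (grid_node N j)) \<in> l2h0 N"
    using \<open>N > 0\<close> by (simp add: l2h0_def grid_node_def grid_step_def)
  have "1/6 * s' (grid_node N (j - 1)) + 2/3 * s' (grid_node N j) + 1/6 * s' (grid_node N (j + 1))
      = (u (j + 1) - u (j - 1)) / (2 * grid_step N)" if j: "j \<in> {1..N-1}" for j
  proof -
    obtain i where i: "j = Suc i" using j by (cases j) auto
    define h where "h = grid_step N"
    have "h > 0" using \<open>N > 0\<close> by (simp add: h_def grid_step_pos)
    have "i < N" "j < N" using j i by auto
    \<comment> \<open>Both sides are \<open>h\<^sup>2 * s''\<close> at node \<open>j\<close>.\<close>
    have "h * (4 * s' (grid_node N j) + 2 * s' (grid_node N i)) - 6 * (u j - u i)
      = 6 * (u (Suc j) - u j) - h * (4 * s' (grid_node N j) + 2 * s' (grid_node N (Suc j)))"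
      using spline_second_derivative_at_nodes(1)[OF spline C1 \<open>i < N\<close>]
        spline_second_derivative_at_nodes(2)[OF spline C1 \<open>j < N\<close>]
      unfolding h_def i by simp
    with \<open>h > 0\<close> show ?thesis
      unfolding h_def[symmetric] i by (simp add: field_simps)
  qed
  with boundary show ?thesis
    by (simp add: is_hermitian_derivative_def)
qed

lemma hermitian_derivative_unique:
  assumes "is_hermitian_derivative N u v" "is_hermitian_derivative N u w" "j \<le> N"
  shows "v j = w j"
proof -
  have "v j - w j = 0"
  proof (rule tridiagonal_solution_zero[where e = "\<lambda>j. v j - w j" and N = N])
    fix i assume "i \<in> {1..N-1}"
    then have "1/6 * v (i - 1) + 2/3 * v i + 1/6 * v (i + 1)
      = 1/6 * w (i - 1) + 2/3 * w i + 1/6 * w (i + 1)"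
      using assms(1,2) by (simp add: is_hermitian_derivative_def)
    then show "1/6 * (v (i - 1) - w (i - 1)) + 2/3 * (v i - w i) + 1/6 * (v (i + 1) - w (i + 1)) = 0"
      by argo
  qed (use assms in \<open>auto simp: is_hermitian_derivative_def l2h0_def\<close>)
  then show ?thesis by simp
qed

theorem proposition4p1:
  fixes N :: nat and u ux :: "nat \<Rightarrow> real" and s :: "real \<Rightarrow> real"
  assumes "N \<ge> 2"
    and "u \<in> l2h0 N"
    and "is_cubic_spline N u s"
    and "is_hermitian_derivative N u ux"
  shows "\<forall>j\<in>{1..N-1}. (s has_real_derivative ux j) (at (grid_node N j))"
proof
  fix j assume j: "j \<in> {1..N-1}"
  obtain s' s'' where C1: "C1_with s s'" "C1_with s' s''"
    using assms(3) by (auto simp: is_cubic_spline_def C2_Omega_def)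
  have "is_hermitian_derivative N u (\<lambda>j. s' (grid_node N j))"
    using assms C1 by (intro spline_nodal_slopes_hermitian) auto
  then have slope: "s' (grid_node N j) = ux j"
    using hermitian_derivative_unique[OF _ assms(4)] j by auto
  have inner: "0 < grid_node N j" "grid_node N j < 1"
    using j by (auto simp: grid_node_def grid_step_def divide_simps)
  then have "(s has_real_derivative s' (grid_node N j)) (at (grid_node N j) within {0..1})"
    using C1(1) by (auto simp: C1_with_def)
  then show "(s has_real_derivative ux j) (at (grid_node N j))"
    using inner by (simp add: slope at_within_Icc_at)
qed

end
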